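(* Let $p$ be a prime, let $m$ be a positive integer divisible by $3$, let $n=\frac m3(p-1)$ and $U=[0,n]^2$. Let $i$ be an integer with $0\le i\le n$, let $J_0,\dots,J_{i-1}$ be a forward consistent sequence of ideals of $U$, and let $J_i$ be an ideal of $U$. Then $J_i$ is consistent with $J_0,\dots,J_{i-1}$ if and only if the following conditions hold: (i) $J_i\subseteq J_{i-1}$; (ii) $J_i\supseteq\bigl[J_{i-1}+D-(0,p)\bigr]\cap U$; (iii) $\bigl[J_i+D+(1,0)\bigr]\cap U\subseteq J_{i-p}$ (void if $i-p<0$); (iv) if there exists an integer $\beta$ with $1\le\beta\le p-1$, $i-\beta\ge 0$ and $J_{i-\beta}\ne U$, then, letting $\beta_i$ be the largest such integer, $\bigl[J_i+D+(1,-p^2+p\beta_i)\bigr]\cap U\subseteq J_{i-\beta_i}$ (if no such $\beta$ exists, this condition is void).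
   Context: $D=\{(x,y)\in\mathbb{R}^2: x+py\le 0,\ p^2x+y\le 0\}$ and $\Delta=\{(x,y,z)\in\mathbb{R}^3: x+py+p^2z\le 0,\ p^2x+y+pz\le 0,\ px+p^2y+z\le 0\}$. For $u,v\in\mathbb{R}^2$, $u\prec v$ means $u\in v+D$; for $u,v\in\mathbb{R}^3$, $u\prec v$ means $u\in v+\Delta$. For $\Omega\subseteq\mathbb{R}^2$ or $\mathbb{R}^3$, an ideal of $\Omega$ is a subset $I\subseteq\Omega$ such that $u\in I$, $v\in\Omega$, $v\prec u$ imply $v\in I$. For integers $a\le b$, $[a,b]=\{x\in\mathbb{Z}:a\le x\le b\}$. Sums like $J+D+(a,b)$ are Minkowski sums in $\mathbb{R}^2$. A sequence $J_0,\dots,J_{i-1}$ of ideals of $U$ is forward consistent if $\bigcup_{j=0}^{i-1}(J_j\times\{j\})$ is an ideal of $U\times[0,i-1]$ (with respect to $\prec$ on $\mathbb{R}^3$); $J_i$ is consistent with $J_0,\dots,J_{i-1}$ if $J_0,\dots,J_{i-1},J_i$ is forward consistent. *)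

theory Defs
  imports Complex_Main "HOL-Library.Set_Algebras" "HOL-Library.Product_Plus"
    "HOL-Computational_Algebra.Primes"
begin

text \<open>
  Points of the plane are pairs of reals. Points of 3-space are nested to the left, so that
  \<open>J \<times> {j}\<close> is literally a set of points of 3-space when \<open>J\<close> is a planar set.
  The sum of two sets is the Minkowski sum of \<^theory>\<open>HOL-Library.Set_Algebras\<close>, and a
  translation is written as the Minkowski sum with a singleton.
\<close>

type_synonym plane = "real \<times> real"
type_synonym space = "(real \<times> real) \<times> real"

definition D :: "nat \<Rightarrow> plane set" where
  "D p = {(x, y). x + real p * y \<le> 0 \<and> (real p)^2 * x + y \<le> 0}"

definition \<Delta> :: "nat \<Rightarrow> space set" where
  "\<Delta> p = {((x, y), z).
     x + real p * y + (real p)^2 * z \<le> 0 \<and>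
     (real p)^2 * x + y + real p * z \<le> 0 \<and>
     real p * x + (real p)^2 * y + z \<le> 0}"

text \<open>The relation \<open>u \<prec> v\<close>, for the cone \<open>C = D p\<close> in the plane and \<open>C = \<Delta> p\<close> in 3-space.\<close>

definition prec :: "'a::plus set \<Rightarrow> 'a \<Rightarrow> 'a \<Rightarrow> bool" where
  "prec C u v \<longleftrightarrow> u \<in> {v} + C"

definition is_ideal :: "'a::plus set \<Rightarrow> 'a set \<Rightarrow> 'a set \<Rightarrow> bool" where
  "is_ideal C \<Omega> I \<longleftrightarrow> I \<subseteq> \<Omega> \<and> (\<forall>u v. u \<in> I \<longrightarrow> v \<in> \<Omega> \<longrightarrow> prec C v u \<longrightarrow> v \<in> I)"

text \<open>The integer interval \<open>[a, b]\<close>, as a set of reals.\<close>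

definition int_interval :: "int \<Rightarrow> int \<Rightarrow> real set" where
  "int_interval a b = real_of_int ` {a..b}"

text \<open>
  A sequence \<open>J\<^sub>0, \<dots>, J\<^sub>k\<^sub>-\<^sub>1\<close> is given by its length \<open>k\<close> and a function \<open>J\<close> of which only the
  values below \<open>k\<close> matter. The empty sequence (\<open>k = 0\<close>) is forward consistent.
\<close>

definition forward_consistent ::
    "nat \<Rightarrow> plane set \<Rightarrow> nat \<Rightarrow> (nat \<Rightarrow> plane set) \<Rightarrow> bool" where
  "forward_consistent p U k J \<longleftrightarrow>
     (\<forall>j<k. is_ideal (D p) U (J j)) \<and>
     is_ideal (\<Delta> p) (U \<times> int_interval 0 (int k - 1)) (\<Union>j<k. J j \<times> {real j})"

text \<open>The last term \<open>J\<^sub>i\<close> is consistent with \<open>J\<^sub>0, \<dots>, J\<^sub>i\<^sub>-\<^sub>1\<close>.\<close>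

definition consistent ::
    "nat \<Rightarrow> plane set \<Rightarrow> nat \<Rightarrow> (nat \<Rightarrow> plane set) \<Rightarrow> plane set \<Rightarrow> bool" where
  "consistent p U i J K \<longleftrightarrow> forward_consistent p U (Suc i) (J(i := K))"

text \<open>
  The integers \<open>\<beta>\<close> with \<open>1 \<le> \<beta> \<le> p - 1\<close>, \<open>i - \<beta> \<ge> 0\<close> and \<open>J\<^sub>i\<^sub>-\<^sub>\<beta> \<noteq> U\<close>; they are positive, hence
  may be taken as naturals, and subtraction is never truncated.
\<close>

definition proper_gaps :: "nat \<Rightarrow> plane set \<Rightarrow> nat \<Rightarrow> (nat \<Rightarrow> plane set) \<Rightarrow> nat set" where
  "proper_gaps p U i J = {\<beta>. 1 \<le> \<beta> \<and> \<beta> < p \<and> \<beta> \<le> i \<and> J (i - \<beta>) \<noteq> U}"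

end

theory Submission
  imports Defs
begin

text \<open>
  The layers \<open>D\<^sub>k = {(x, y). ((x, y), k) \<in> \<Delta>}\<close> of the cone \<open>\<Delta>\<close> satisfy \<open>D\<^sub>k = D - (0, p k)\<close> for
  \<open>k \<ge> 0\<close>, while the lattice points of \<open>D\<^bsub>-b\<^esub>\<close>, for \<open>b \<ge> 0\<close>, are given by
  \<open>x + p y \<le> \<lfloor>b / p\<rfloor>\<close> and \<open>p\<^sup>2 x + y \<le> p b\<close>. Consistency of \<open>J\<^sub>i\<close> means that for all \<open>j < i\<close>
  the pair \<open>J\<^sub>j, J\<^sub>i\<close> respects these layers in both directions. A comparison between the levels
  \<open>i\<close> and \<open>j\<close> factors, within the square \<open>U\<close>, through a point of the level \<open>i - 1\<close> when the point
  of the level \<open>i\<close> is the smaller one, and through a point of the level \<open>i - p\<close> when it is the larger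
  one and \<open>j < i - p\<close>;
  the hypothesis on the earlier ideals does the rest. For \<open>j = i - b\<close> with \<open>b < p\<close>, every lattice
  point of \<open>D\<^bsub>-b\<^esub>\<close> outside \<open>D\<close> lies in \<open>D + (1, -p\<^sup>2 + p b)\<close>, and a translation by \<open>(0, p (\<beta>\<^sub>i - b))\<close>,
  which stays inside \<open>U\<close>, moves the comparison to the level \<open>i - \<beta>\<^sub>i\<close>.
\<close>

section \<open>Integer arithmetic of the two cones\<close>

definition cone2 :: "int \<Rightarrow> int \<Rightarrow> int \<Rightarrow> bool" where
  "cone2 p x y \<longleftrightarrow> x + p * y \<le> 0 \<and> p^2 * x + y \<le> 0"

definition cone3 :: "int \<Rightarrow> int \<Rightarrow> int \<Rightarrow> int \<Rightarrow> bool" where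
  "cone3 p x y z \<longleftrightarrow>
     x + p * y + p^2 * z \<le> 0 \<and> p^2 * x + y + p * z \<le> 0 \<and> p * x + p^2 * y + z \<le> 0"

lemma le_zdiv_iff:
  fixes p q b :: int
  assumes "p > 0"
  shows "q \<le> b div p \<longleftrightarrow> p * q \<le> b"
proof
  assume "q \<le> b div p"
  then have "p * q \<le> p * (b div p)"
    using assms by simp
  also have "\<dots> \<le> b"
    using assms by (simp add: minus_mod_eq_mult_div [symmetric])
  finally show "p * q \<le> b" .
next
  assume "p * q \<le> b"
  then show "q \<le> b div p"
    using zdiv_mono1[of "p * q" b p] assms by simp
qed

text \<open>The third inequality of \<Delta> follows from \<open>p\<close> times the first one,
  because \<open>k \<le> p^3 * k\<close>; the other two are those of \<open>cone2\<close> at the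
  shifted point.\<close>

lemma cone3_nonneg_iff:
  assumes "p \<ge> 1" "k \<ge> 0"
  shows "cone3 p x y k \<longleftrightarrow> cone2 p x (y + p * k)"
proof -
  have "p * x + p^2 * y + k \<le> 0" if "x + p * y + p^2 * k \<le> 0"
  proof -
    have "p * (x + p * y + p^2 * k) \<le> 0"
      using that assms by (simp add: mult_nonneg_nonpos)
    moreover have "1 * k \<le> p^3 * k"
      using assms by (intro mult_right_mono) auto
    ultimately show ?thesis
      by (simp add: algebra_simps power2_eq_square power3_eq_cube)
  qed
  then show ?thesis
    by (auto simp: cone3_def cone2_def algebra_simps power2_eq_square)
qed

text \<open>Dividing the third inequality by \<open>p\<close> and rounding down gives the bound
  \<open>b div p\<close>, which implies the first one because
  \<open>b div p \<le> b \<le> p^2 * b\<close>.\<close>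

lemma cone3_nonpos_iff:
  assumes "p \<ge> 1" "b \<ge> 0"
  shows "cone3 p x y (- b) \<longleftrightarrow> x + p * y \<le> b div p \<and> p^2 * x + y \<le> p * b"
proof -
  have "b div p \<le> b"
    using zdiv_mono2[of b 1 p] assms by simp
  moreover have "1 * b \<le> p^2 * b"
    using assms by (intro mult_right_mono) auto
  ultimately have "x + p * y \<le> p^2 * b" if "x + p * y \<le> b div p"
    using that by linarith
  moreover have "x + p * y \<le> b div p \<longleftrightarrow> p * x + p^2 * y \<le> b"
    using assms by (simp add: le_zdiv_iff algebra_simps power2_eq_square)
  ultimately show ?thesis
    by (auto simp: cone3_def)
qed

text \<open>The displacement over \<open>k\<close> levels splits into \<open>(s, t)\<close> over
  \<open>k - 1\<close> levels and a rest over one level. Keeping \<open>(s, t)\<close> in the box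
  spanned by the origin and \<open>(x, y)\<close> prevents the intermediate point from leaving the
  square.\<close>

lemma cone2_up_step:
  assumes "p \<ge> 1" "k \<ge> 1" and c: "cone2 p x (y + p * k)"
  obtains s t where "cone2 p s (t + p * (k - 1))" "cone2 p (x - s) (y - t + p)"
    "min 0 x \<le> s" "s \<le> max 0 x" "min 0 y \<le> t" "t \<le> max 0 y"
proof (cases "y \<le> - p")
  case True
  \<comment> \<open>The rest is \<open>(0, - p)\<close>, the apex of the layer of height 1.\<close>
  show ?thesis
    by (rule that[of x "y + p"]) (use c True assms in \<open>auto simp: cone2_def algebra_simps\<close>)
next
  case False
  \<comment> \<open>With \<open>t = 0\<close>, this \<open>s\<close> makes the first inequality of
    the rest an equality.\<close>
  define s where "s = x + p * (p + y)"
  have s: "s + p * (p * (k - 1)) \<le> 0"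
    using c by (simp add: cone2_def s_def algebra_simps)
  have nn: "0 \<le> p * (k - 1)" "0 \<le> p * (p * (k - 1))"
    using assms by auto
  have "0 \<le> p * (p + y)"
    using False assms by simp
  then have "x \<le> s" "s \<le> 0"
    using s nn by (auto simp: s_def)
  have "p^2 * (s + p * (p * (k - 1))) \<le> 0"
    using s by (simp add: mult_nonneg_nonpos)
  moreover have "1 * (p * (k - 1)) \<le> p^3 * (p * (k - 1))"
    using nn assms by (intro mult_right_mono) auto
  ultimately have 1: "cone2 p s (0 + p * (k - 1))"
    using s by (simp add: cone2_def algebra_simps power2_eq_square power3_eq_cube)
  have "1 * (p + y) \<le> p^3 * (p + y)"
    using False assms by (intro mult_right_mono) auto
  then have 2: "cone2 p (x - s) (y - 0 + p)"
    by (simp add: cone2_def s_def algebra_simps power2_eq_square power3_eq_cube)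
  show ?thesis
    by (rule that[OF 1 2]) (use \<open>x \<le> s\<close> \<open>s \<le> 0\<close> in auto)
qed

text \<open>For \<open>b < p\<close> the quotient \<open>b div p\<close> is 0, so outside D it is
  the second inequality of D that fails. Together with \<open>x + p * y \<le> 0\<close> this forces
  \<open>x \<ge> 1\<close>, from which the other bounds follow.\<close>

lemma cone3_down_small:
  assumes "p \<ge> 1" "0 \<le> b" "b < p" and c: "cone3 p x y (- b)" and "\<not> cone2 p x y"
  shows "x \<ge> 1" "y \<le> p * b - p^2" "cone2 p (x - 1) (y - (- (p^2) + p * b))"
proof -
  have le: "x + p * y \<le> 0" "p^2 * x + y \<le> p * b"
    using c assms by (simp_all add: cone3_nonpos_iff)
  then have pos: "p^2 * x + y > 0"
    using assms(5) by (simp add: cone2_def)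
  show x: "x \<ge> 1"
  proof (rule ccontr)
    assume "\<not> x \<ge> 1"
    then have "p^3 * x \<le> 1 * x"
      using assms by (intro mult_right_mono_neg) auto
    moreover have "0 < p * (p^2 * x + y)"
      using pos assms by simp
    ultimately show False
      using le by (simp add: algebra_simps power2_eq_square power3_eq_cube)
  qed
  have "p^2 * 1 \<le> p^2 * x"
    using x by (intro mult_left_mono) auto
  then show "y \<le> p * b - p^2"
    using le by simp
  have "p * (p^2 * (x - 1) + y + p^2 - p * b) \<le> 0"
    using le assms by (intro mult_nonneg_nonpos) (auto simp: algebra_simps)
  moreover have "1 * (x - 1) \<le> p^3 * (x - 1)"
    using x assms by (intro mult_right_mono) auto
  ultimately show "cone2 p (x - 1) (y - (- (p^2) + p * b))"
    using le by (simp add: cone2_def algebra_simps power2_eq_square power3_eq_cube)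
qed

text \<open>The first inequality of the translated cone bounds \<open>x + p * y\<close> by
  \<open>1 - p^3 + p^2 * b\<close>, which is at most \<open>1 - p^2\<close> since
  \<open>b \<le> p - 1\<close>.\<close>

lemma cone3_of_cone2_gap:
  assumes "p \<ge> 1" "0 \<le> b" "b < p" and c: "cone2 p (x - 1) (y - (- (p^2) + p * b))"
  shows "cone3 p x y (- b)"
proof -
  have "p^2 * (b + 1) \<le> p^2 * p"
    using assms by (intro mult_left_mono) auto
  moreover have "1 \<le> p^2"
    using assms by simp
  ultimately have "x + p * y \<le> 0"
    using c by (simp add: cone2_def algebra_simps power2_eq_square)
  then show ?thesis
    using c assms by (simp add: cone3_nonpos_iff cone2_def algebra_simps)
qed

lemma cone3_neg_p_iff:
  assumes "p \<ge> 1"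
  shows "cone3 p x y (- p) \<longleftrightarrow> cone2 p (x - 1) y"
  using assms by (auto simp: cone3_nonpos_iff cone2_def algebra_simps power2_eq_square)

text \<open>Passing from \<open>b\<close> to \<open>b - p\<close> lowers the two bounds by 1 and
  \<open>p^2\<close>, exactly the contributions of \<open>(1, 0)\<close>.\<close>

lemma cone3_down_step_right:
  assumes "p \<ge> 1" "p \<le> b" and c: "cone3 p x y (- b)"
  shows "cone3 p (x - 1) y (- (b - p))"
proof -
  have "(b - p) div p = b div p - 1"
    using div_add_self2[of p "b - p"] assms by simp
  then show ?thesis
    using c assms cone3_nonpos_iff[of p b x y] cone3_nonpos_iff[of p "b - p" "x - 1" y]
    by (auto simp: algebra_simps power2_eq_square)
qed

text \<open>Replaces the previous step when the right border of the square blocks the translation by \<open>(1, 0)\<close>.\<close>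

lemma cone3_down_step_left:
  assumes "p \<ge> 2" "p < b" "x \<le> 0" and c: "cone3 p x y (- b)"
  shows "cone3 p x y (- (b - p)) \<or> y \<ge> 1 \<and> cone3 p (x + p - 1) (y - 1) (- (b - p))"
proof -
  have div: "(b - p) div p = b div p - 1"
    using div_add_self2[of p "b - p"] assms by simp
  define q where "q = b div p"
  have q: "q \<ge> 1" "p * q \<le> b"
    using assms le_zdiv_iff[of p 1 b] le_zdiv_iff[of p q b] by (simp_all add: q_def)
  have le: "x + p * y \<le> q" "p^2 * x + y \<le> p * b"
    using c assms by (simp_all add: cone3_nonpos_iff q_def)
  have iff: "cone3 p x' y' (- (b - p)) \<longleftrightarrow> x' + p * y' \<le> q - 1 \<and> p^2 * x' + y' \<le> p * (b - p)"
    for x' y'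
    using assms by (subst cone3_nonpos_iff) (simp_all only: div q_def)
  show ?thesis
  \<comment> \<open>If the rounded inequality is strict, the same displacement already fits
    \<open>b - p\<close>. If it is an equality, subtracting \<open>(1 - p, 1)\<close> lowers
    \<open>x + p * y\<close> by exactly 1.\<close>
  proof (cases "x + p * y = q")
    case False
    have "p^3 * x \<le> 1 * x"
      using assms by (intro mult_right_mono_neg) auto
    then have "p * (p^2 * x + y) \<le> q"
      using le by (simp add: algebra_simps power2_eq_square power3_eq_cube)
    also have "q \<le> b"
    proof -
      have "1 * q \<le> p * q"
        using q assms by (intro mult_right_mono) auto
      then show ?thesis
        using q by linarith
    qed
    \<comment> \<open>Here \<open>p < b\<close> must be strict: the right side vanishes at
      \<open>b = p\<close>.\<close>
    also have "b \<le> p * (p * (b - p))"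
    proof -
      define r where "r = b - p"
      have "r \<ge> 1"
        using assms by (simp add: r_def)
      then have "p * 1 \<le> p * r" "1 * r \<le> p * r" "2 * (p * r) \<le> p * (p * r)"
        using assms by (intro mult_left_mono mult_right_mono; simp)+
      then have "p + r \<le> p * (p * r)"
        by linarith
      then show ?thesis
        by (simp add: r_def)
    qed
    finally have "p^2 * x + y \<le> p * (b - p)"
      using assms by simp
    then show ?thesis
      unfolding iff using False le by linarith
  next
    case True
    have "0 < p * y"
      using True q assms by linarith
    then have y: "y \<ge> 1"
      using assms by (simp add: zero_less_mult_iff)
    have x: "x = q - p * y"
      using True by simp
    have "p * (p * q) \<le> p * b"
      using q assms by simp
    \<comment> \<open>Once \<open>x\<close> is eliminated, the left side of the second inequality is
      \<open>p^2 * q - p^2 - (p^3 - 1) * (y - 1)\<close>.\<close>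
    moreover have "0 \<le> (p^3 - 1) * (y - 1)"
      using y assms by simp
    ultimately have "p^2 * (x + p - 1) + (y - 1) \<le> p * (b - p)"
      by (simp only: x) (simp add: algebra_simps power2_eq_square power3_eq_cube)
    then show ?thesis
      unfolding iff using True y by (simp add: algebra_simps)
  qed
qed


section \<open>Lattice points and transfer to the real cones\<close>

definition lat :: "int \<Rightarrow> int \<Rightarrow> plane" where
  "lat x y = (real_of_int x, real_of_int y)"

lemma lat_diff: "lat x y - lat x' y' = lat (x - x') (y - y')"
  by (simp add: lat_def)

lemma lat_mem_D_iff: "lat x y \<in> D p \<longleftrightarrow> cone2 (int p) x y"
proof -
  have "real_of_int x + real p * real_of_int y = of_int (x + int p * y)"
    "(real p)^2 * real_of_int x + real_of_int y = of_int ((int p)^2 * x + y)"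
    by simp_all
  then show ?thesis
    by (simp only: lat_def D_def cone2_def mem_Collect_eq case_prod_conv of_int_le_0_iff)
qed

lemma lat_mem_Delta_iff: "(lat x y, real_of_int z) \<in> \<Delta> p \<longleftrightarrow> cone3 (int p) x y z"
proof -
  have "real_of_int x + real p * real_of_int y + (real p)^2 * real_of_int z
      = of_int (x + int p * y + (int p)^2 * z)"
    "(real p)^2 * real_of_int x + real_of_int y + real p * real_of_int z
      = of_int ((int p)^2 * x + y + int p * z)"
    "real p * real_of_int x + (real p)^2 * real_of_int y + real_of_int z
      = of_int (int p * x + (int p)^2 * y + z)"
    by simp_all
  then show ?thesis
    by (simp only: lat_def \<Delta>_def cone3_def mem_Collect_eq case_prod_conv of_int_le_0_iff)
qed

lemma prec_iff_diff_mem: "prec C u v \<longleftrightarrow> u - v \<in> C" for u v :: "'a::ab_group_add"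
proof
  assume "u - v \<in> C"
  then have "v + (u - v) \<in> {v} + C"
    by (intro set_plus_intro) auto
  then show "prec C u v"
    by (simp add: prec_def)
qed (auto simp: prec_def set_plus_def)

lemma mem_translate_iff: "w \<in> A + C + {c} \<longleftrightarrow> (\<exists>u\<in>A. w - u - c \<in> C)"
  for w :: "'a::ab_group_add"
proof
  assume "\<exists>u\<in>A. w - u - c \<in> C"
  then obtain u where "u \<in> A" "w - u - c \<in> C"
    by blast
  then have "u + (w - u - c) + c \<in> A + C + {c}"
    by (intro set_plus_intro) auto
  then show "w \<in> A + C + {c}"
    by (simp add: algebra_simps)
qed (force simp: set_plus_def)

section \<open>Consistency as a condition on pairs of levels\<close>

text \<open>The last coordinate identifies the level, so the ideal property of the union splits over
  ordered pairs of levels.\<close>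

lemma forward_consistent_iff:
  assumes "\<forall>j<k. is_ideal (D p) U (J j)"
  shows "forward_consistent p U k J \<longleftrightarrow>
    (\<forall>j<k. \<forall>l<k. \<forall>u\<in>J j. \<forall>w\<in>U. (w - u, real l - real j) \<in> \<Delta> p \<longrightarrow> w \<in> J l)"
proof -
  have sub: "J j \<subseteq> U" if "j < k" for j
    using assms that by (auto simp: is_ideal_def)
  have "{0..int k - 1} = int ` {..<k}"
    by (auto simp: image_iff intro!: bexI[of _ "nat _"])
  then have levels: "int_interval 0 (int k - 1) = real ` {..<k}"
    by (simp add: int_interval_def image_image)
  let ?S = "\<Union>j<k. J j \<times> {real j}"
  have mem: "(u, real j) \<in> ?S \<longleftrightarrow> j < k \<and> u \<in> J j" for u j
    by auto
  have pairs: "(\<forall>u\<in>?S. \<forall>v\<in>U \<times> real ` {..<k}. P v u) \<longleftrightarrow>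
      (\<forall>j<k. \<forall>u\<in>J j. \<forall>w\<in>U. \<forall>l<k. P (w, real l) (u, real j))" for P
    by auto
  have "?S \<subseteq> U \<times> real ` {..<k}"
    using sub by blast
  then have "forward_consistent p U k J \<longleftrightarrow>
      (\<forall>u\<in>?S. \<forall>v\<in>U \<times> real ` {..<k}. v - u \<in> \<Delta> p \<longrightarrow> v \<in> ?S)"
    using assms by (simp only: forward_consistent_def is_ideal_def[of "\<Delta> p"] prec_iff_diff_mem levels) blast
  also have "\<dots> \<longleftrightarrow> (\<forall>j<k. \<forall>u\<in>J j. \<forall>w\<in>U. \<forall>l<k.
      (w, real l) - (u, real j) \<in> \<Delta> p \<longrightarrow> (w, real l) \<in> ?S)"
    by (rule pairs)
  also have "\<dots> \<longleftrightarrow> (\<forall>j<k. \<forall>l<k. \<forall>u\<in>J j. \<forall>w\<in>U.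
      (w - u, real l - real j) \<in> \<Delta> p \<longrightarrow> w \<in> J l)"
    unfolding mem by (simp only: diff_Pair) blast
  finally show ?thesis .
qed

lemma Delta_level_0: "(v, 0) \<in> \<Delta> p \<Longrightarrow> v \<in> D p"
  by (auto simp: \<Delta>_def D_def)

text \<open>Pairs of earlier levels are settled by \<open>fc\<close>, and the pair
  \<open>(i, i)\<close> by \<open>K\<close> being an ideal, since the layer of \<Delta> at height 0
  lies in D.\<close>

lemma consistent_iff:
  assumes J: "\<forall>j<i. is_ideal (D p) U (J j)" and fc: "forward_consistent p U i J"
    and K: "is_ideal (D p) U K"
  shows "consistent p U i J K \<longleftrightarrow>
    (\<forall>j<i. \<forall>u\<in>K. \<forall>w\<in>U. (w - u, real j - real i) \<in> \<Delta> p \<longrightarrow> w \<in> J j) \<and>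
    (\<forall>j<i. \<forall>u\<in>J j. \<forall>w\<in>U. (w - u, real i - real j) \<in> \<Delta> p \<longrightarrow> w \<in> K)"
proof -
  define R where "R A B j l \<longleftrightarrow>
    (\<forall>u\<in>A. \<forall>w\<in>U. (w - u, real l - real j) \<in> \<Delta> p \<longrightarrow> w \<in> B)" for A B j l
  let ?H = "J(i := K)"
  have H: "\<forall>j<Suc i. is_ideal (D p) U (?H j)"
    using J K by (auto simp: less_Suc_eq)
  have "w \<in> K" if "u \<in> K" "w \<in> U" "(w - u, 0) \<in> \<Delta> p" for u w
  proof -
    have "prec (D p) w u"
      unfolding prec_iff_diff_mem using that(3) by (rule Delta_level_0)
    then show ?thesis
      using K that(1,2) unfolding is_ideal_def by metis
  qed
  then have "R K K i i"
    by (simp add: R_def)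
  moreover have "\<forall>j<i. \<forall>l<i. R (J j) (J l) j l"
    using fc unfolding forward_consistent_iff[OF J] R_def .
  moreover have "consistent p U i J K \<longleftrightarrow> (\<forall>j<Suc i. \<forall>l<Suc i. R (?H j) (?H l) j l)"
    unfolding consistent_def forward_consistent_iff[OF H] R_def ..
  ultimately have "consistent p U i J K \<longleftrightarrow> (\<forall>j<i. R K (J j) i j) \<and> (\<forall>j<i. R (J j) K j i)"
    by (auto simp: less_Suc_eq)
  then show ?thesis
    unfolding R_def .
qed

section \<open>The ideals inside the square\<close>

text \<open>\<open>K\<close> stands for the candidate \<open>J\<^sub>i\<close>. The bound
  \<open>n \<ge> p - 1\<close> leaves room for a detour of \<open>p - 1\<close> to the left of the
  right border.\<close>

locale grid =
  fixes p n i :: nat and U :: "plane set" and J :: "nat \<Rightarrow> plane set" and K :: "plane set"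
  assumes p: "p \<ge> 2" and n: "n \<ge> p - 1"
    and U_def: "U = int_interval 0 (int n) \<times> int_interval 0 (int n)"
    and J: "\<forall>j<i. is_ideal (D p) U (J j)" and fc: "forward_consistent p U i J"
    and K: "is_ideal (D p) U K"
begin

lemma lat_mem_U_iff: "lat x y \<in> U \<longleftrightarrow> 0 \<le> x \<and> x \<le> int n \<and> 0 \<le> y \<and> y \<le> int n"
  by (auto simp: U_def int_interval_def lat_def)

lemma U_cases:
  assumes "u \<in> U"
  obtains x y where "u = lat x y" "0 \<le> x" "x \<le> int n" "0 \<le> y" "y \<le> int n"
  using assms by (auto simp: U_def int_interval_def lat_def)

lemma J_sub: "j < i \<Longrightarrow> J j \<subseteq> U" and K_sub: "K \<subseteq> U"
  using J K by (auto simp: is_ideal_def)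

lemma J_mono:
  assumes "j < i" "l < i" "lat a b \<in> J j" "lat c d \<in> U"
    "cone3 (int p) (c - a) (d - b) (int l - int j)"
  shows "lat c d \<in> J l"
proof -
  have "(lat c d - lat a b, real l - real j) \<in> \<Delta> p"
    using assms(5) lat_mem_Delta_iff[of "c - a" "d - b" "int l - int j" p] by (simp add: lat_diff)
  then show ?thesis
    using fc assms unfolding forward_consistent_iff[OF J] by blast
qed

text \<open>The zero displacement belongs to every layer of nonpositive height.\<close>

lemma J_antimono:
  assumes "j \<le> l" "l < i"
  shows "J l \<subseteq> J j"
proof
  fix u assume u: "u \<in> J l"
  then obtain x y where xy: "u = lat x y"
    using J_sub assms U_cases by blast
  have "cone3 (int p) (x - x) (y - y) (- (int l - int j))"
    using assms p by (subst cone3_nonpos_iff) (simp_all add: pos_imp_zdiv_nonneg_iff)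
  moreover have "lat x y \<in> U" "lat x y \<in> J l"
    using u J_sub[of l] assms xy by blast+
  ultimately show "u \<in> J j"
    unfolding xy using assms by (intro J_mono[of l j x y x y]) auto
qed

lemma ball_lat_iff:
  assumes "A \<subseteq> U"
  shows "(\<forall>u\<in>A. P u) \<longleftrightarrow> (\<forall>a b. lat a b \<in> A \<longrightarrow> P (lat a b))"
  using assms U_cases by blast

lemma ball_Delta_iff:
  assumes "A \<subseteq> U"
  shows "(\<forall>u\<in>A. \<forall>w\<in>U. (w - u, real l - real j) \<in> \<Delta> p \<longrightarrow> w \<in> B) \<longleftrightarrow>
    (\<forall>a b c d. lat a b \<in> A \<longrightarrow> lat c d \<in> U \<longrightarrow>
      cone3 (int p) (c - a) (d - b) (int l - int j) \<longrightarrow> lat c d \<in> B)"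
proof -
  have "(lat c d - lat a b, real l - real j) \<in> \<Delta> p \<longleftrightarrow>
      cone3 (int p) (c - a) (d - b) (int l - int j)" for a b c d
    using lat_mem_Delta_iff[of "c - a" "d - b" "int l - int j" p] by (simp add: lat_diff)
  then show ?thesis
    by (simp add: ball_lat_iff[OF assms] ball_lat_iff[OF subset_refl])
qed

lemma translate_subset_iff:
  assumes "A \<subseteq> U"
  shows "(A + D p + {lat e f}) \<inter> U \<subseteq> B \<longleftrightarrow>
    (\<forall>a b c d. lat a b \<in> A \<longrightarrow> lat c d \<in> U \<longrightarrow>
      cone2 (int p) (c - a - e) (d - b - f) \<longrightarrow> lat c d \<in> B)"
proof -
  have "lat c d - lat a b - lat e f \<in> D p \<longleftrightarrow> cone2 (int p) (c - a - e) (d - b - f)" for a b c d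
    by (simp add: lat_diff lat_mem_D_iff)
  moreover have "(A + D p + {lat e f}) \<inter> U \<subseteq> B \<longleftrightarrow>
      (\<forall>u\<in>A. \<forall>w\<in>U. w - u - lat e f \<in> D p \<longrightarrow> w \<in> B)"
    unfolding subset_iff Int_iff mem_translate_iff by blast
  ultimately show ?thesis
    by (simp add: ball_lat_iff[OF assms] ball_lat_iff[OF subset_refl])
qed

section \<open>Comparisons with the smaller point at level \<open>i\<close>\<close>

text \<open>The case \<open>j = i - 1\<close> is condition (ii). For smaller \<open>j\<close>, the
  first part of the split displacement leads to \<open>J (i - 1)\<close> by forward consistency, and
  the rest is again condition (ii).\<close>

lemma up_iff:
  "(\<forall>j<i. \<forall>u\<in>J j. \<forall>w\<in>U. (w - u, real i - real j) \<in> \<Delta> p \<longrightarrow> w \<in> K) \<longleftrightarrow>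
   (i \<ge> 1 \<longrightarrow> (J (i - 1) + D p + {lat 0 (- int p)}) \<inter> U \<subseteq> K)" (is "?up \<longleftrightarrow> ?ii")
proof -
  have up: "?up \<longleftrightarrow> (\<forall>j<i. \<forall>a b c d. lat a b \<in> J j \<longrightarrow> lat c d \<in> U \<longrightarrow>
      cone2 (int p) (c - a) (d - b + int p * (int i - int j)) \<longrightarrow> lat c d \<in> K)"
    using p by (auto simp: ball_Delta_iff J_sub cone3_nonneg_iff)
  have ii: "?ii \<longleftrightarrow> (i \<ge> 1 \<longrightarrow> (\<forall>a b c d. lat a b \<in> J (i - 1) \<longrightarrow> lat c d \<in> U \<longrightarrow>
      cone2 (int p) (c - a) (d - b + int p) \<longrightarrow> lat c d \<in> K))"
    by (auto simp: translate_subset_iff J_sub)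
  show ?thesis
    unfolding up ii
  proof (intro iffI impI allI)
    fix a b c d
    assume "\<forall>j<i. \<forall>a b c d. lat a b \<in> J j \<longrightarrow> lat c d \<in> U \<longrightarrow>
        cone2 (int p) (c - a) (d - b + int p * (int i - int j)) \<longrightarrow> lat c d \<in> K"
      and "1 \<le> i" "lat a b \<in> J (i - 1)" "lat c d \<in> U" "cone2 (int p) (c - a) (d - b + int p)"
    then show "lat c d \<in> K"
      by (auto dest!: spec[of _ "i - 1"] simp: of_nat_diff)
  next
    fix j a b c d
    assume ii: "1 \<le> i \<longrightarrow> (\<forall>a b c d. lat a b \<in> J (i - 1) \<longrightarrow> lat c d \<in> U \<longrightarrow>
        cone2 (int p) (c - a) (d - b + int p) \<longrightarrow> lat c d \<in> K)"
      and j: "j < i" and u: "lat a b \<in> J j" and w: "lat c d \<in> U"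
      and c: "cone2 (int p) (c - a) (d - b + int p * (int i - int j))"
    obtain s t where st: "cone2 (int p) s (t + int p * (int i - int j - 1))"
        "cone2 (int p) (c - a - s) (d - b - t + int p)"
        "min 0 (c - a) \<le> s" "s \<le> max 0 (c - a)" "min 0 (d - b) \<le> t" "t \<le> max 0 (d - b)"
      by (rule cone2_up_step[OF _ _ c]) (use p j in auto)
    have v: "lat (a + s) (b + t) \<in> U"
      using u w st J_sub[OF j] by (auto simp: lat_mem_U_iff dest!: subsetD)
    have "cone3 (int p) s t (int i - int j - 1)"
      using st j p by (simp add: cone3_nonneg_iff)
    then have "lat (a + s) (b + t) \<in> J (i - 1)"
      using j by (intro J_mono[OF j _ u v]) (simp_all add: of_nat_diff algebra_simps)
    then show "lat c d \<in> K"
      using ii j w st(2) by (auto simp: algebra_simps dest!: spec[of _ c] spec[of _ d])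
  qed
qed

section \<open>Comparisons with the larger point at level \<open>i\<close>\<close>

lemma K_ideal:
  assumes "lat a b \<in> K" "lat c d \<in> U" "cone2 (int p) (c - a) (d - b)"
  shows "lat c d \<in> K"
proof -
  have "prec (D p) (lat c d) (lat a b)"
    using assms(3) by (simp add: prec_iff_diff_mem lat_diff lat_mem_D_iff)
  then show ?thesis
    using K assms(1,2) unfolding is_ideal_def by metis
qed

lemma K_sub_J:
  assumes "K \<subseteq> J (i - 1)" "1 \<le> \<beta>" "\<beta> \<le> i"
  shows "K \<subseteq> J (i - \<beta>)"
  using assms(1)
proof (rule order.trans)
  show "J (i - 1) \<subseteq> J (i - \<beta>)"
    using assms(2,3) by (intro J_antimono) linarith+
qed

lemma finite_gaps: "finite (proper_gaps p U i J)"
  by (rule finite_subset[of _ "{..<p}"]) (auto simp: proper_gaps_def)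

text \<open>Outside D, condition (iv) is available only at level \<open>i - B\<close>; the target is
  raised to reach that level and then lowered again by forward consistency.\<close>

lemma down_gap:
  assumes sub: "K \<subseteq> J (i - 1)" and ne: "\<beta> \<in> proper_gaps p U i J"
    and B: "B = Max (proper_gaps p U i J)"
    and iv: "\<And>a b c d. lat a b \<in> K \<Longrightarrow> lat c d \<in> U \<Longrightarrow>
      cone2 (int p) (c - a - 1) (d - b - (- ((int p)^2) + int p * int B)) \<Longrightarrow> lat c d \<in> J (i - B)"
    and u: "lat a b \<in> K" and w: "lat c d \<in> U" and c: "cone3 (int p) (c - a) (d - b) (- int \<beta>)"
  shows "lat c d \<in> J (i - \<beta>)"
proof -
  have \<beta>: "1 \<le> \<beta>" "\<beta> < p" "\<beta> \<le> i"
    using ne by (auto simp: proper_gaps_def)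
  have "B \<in> proper_gaps p U i J" "\<beta> \<le> B"
    using Max_in[OF finite_gaps] Max_ge[OF finite_gaps ne] ne B by auto
  then have B: "B < p" "B \<le> i" "1 \<le> B" "\<beta> \<le> B"
    by (auto simp: proper_gaps_def)
  show ?thesis
  proof (cases "cone2 (int p) (c - a) (d - b)")
    case True
    then show ?thesis
      using K_ideal[OF u w] K_sub_J[OF sub \<beta>(1,3)] by blast
  next
    case False
    note small = cone3_down_small[OF _ _ _ c False]
    have d: "d - b \<le> int p * int \<beta> - (int p)^2"
      and c2: "cone2 (int p) (c - a - 1) (d - b - (- ((int p)^2) + int p * int \<beta>))"
      using small \<beta> by auto
    define e where "e = int p * (int B - int \<beta>)"
    \<comment> \<open>The raised point stays below \<open>b\<close>, hence in the square:
      \<open>d + e - b\<close> is at most \<open>p * B - p^2\<close>.\<close>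
    have "int p * int B \<le> (int p)^2"
      unfolding power2_eq_square using B by (intro mult_left_mono) auto
    moreover have "e = int p * int B - int p * int \<beta>"
      by (simp add: e_def algebra_simps)
    ultimately have "d + e \<le> b"
      using d by linarith
    moreover have "0 \<le> e"
      using B by (simp add: e_def)
    ultimately have v: "lat c (d + e) \<in> U"
      using u w K_sub by (auto simp: lat_mem_U_iff dest!: subsetD)
    have "lat c (d + e) \<in> J (i - B)"
      by (rule iv[OF u v]) (use c2 in \<open>simp add: e_def algebra_simps\<close>)
    \<comment> \<open>The displacement \<open>(0, - e)\<close> is the apex of the layer of height
      \<open>B - \<beta>\<close>.\<close>
    moreover have "cone3 (int p) (c - c) (d - (d + e)) (int (i - \<beta>) - int (i - B))"
      using B \<beta> p by (simp add: of_nat_diff cone3_nonneg_iff cone2_def e_def)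
    ultimately show ?thesis
      using B \<beta> w by (intro J_mono[of "i - B" "i - \<beta>"]) auto
  qed
qed

text \<open>Condition (iii) leads from level \<open>i\<close> to level \<open>i - p\<close>, and
  forward consistency covers the remaining \<open>\<beta> - p\<close> levels. On the border
  \<open>a = n\<close> the intermediate point is \<open>(a, b)\<close> itself or lies up and to the
  left of it.\<close>

lemma down_large:
  assumes sub: "K \<subseteq> J (i - 1)"
    and iii: "\<And>a b c d. lat a b \<in> K \<Longrightarrow> lat c d \<in> U \<Longrightarrow>
      cone2 (int p) (c - a - 1) (d - b) \<Longrightarrow> lat c d \<in> J (i - p)"
    and \<beta>: "p < \<beta>" "\<beta> \<le> i"
    and u: "lat a b \<in> K" and w: "lat c d \<in> U" and c: "cone3 (int p) (c - a) (d - b) (- int \<beta>)"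
  shows "lat c d \<in> J (i - \<beta>)"
proof -
  have through: "lat c d \<in> J (i - \<beta>)"
    if "lat s t \<in> J (i - p)" "cone3 (int p) (c - s) (d - t) (- (int \<beta> - int p))" for s t
    using that \<beta> p w by (intro J_mono[of "i - p" "i - \<beta>" s t]) (auto simp: of_nat_diff)
  have bounds: "0 \<le> a" "a \<le> int n" "0 \<le> b" "b \<le> int n" "c \<le> int n" "d \<le> int n"
    using u w K_sub by (auto simp: lat_mem_U_iff dest!: subsetD)
  show ?thesis
  proof (cases "a < int n")
    case True
    then have "lat (a + 1) b \<in> J (i - p)"
      using bounds by (intro iii[OF u]) (auto simp: lat_mem_U_iff cone2_def)
    then show ?thesis
      using cone3_down_step_right[OF _ _ c] p \<beta> by (intro through) (auto simp: algebra_simps)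
  next
    case False
    then consider "cone3 (int p) (c - a) (d - b) (- (int \<beta> - int p))"
      | "d - b \<ge> 1" "cone3 (int p) (c - a + int p - 1) (d - b - 1) (- (int \<beta> - int p))"
      using cone3_down_step_left[OF _ _ _ c] p \<beta> bounds by auto
    then show ?thesis
    proof cases
      case 1
      have "lat a b \<in> J (i - p)"
        using u K_sub_J[OF sub, of p] \<beta> p by auto
      then show ?thesis
        using 1 by (rule through)
    next
      case 2
      \<comment> \<open>The detour \<open>(1 - p, 1)\<close> is \<open>(1, 0)\<close> plus the
        vector \<open>(- p, 1)\<close> on the boundary of D. It stays in the square because
        \<open>a = n \<ge> p - 1\<close> and \<open>b + 1 \<le> d\<close>.\<close>
      have "1 \<le> int p ^ 3"
        using p by simp
      then have "cone2 (int p) (- int p) 1"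
        by (simp add: cone2_def power2_eq_square power3_eq_cube)
      then have "lat (a + 1 - int p) (b + 1) \<in> J (i - p)"
        using False 2 bounds n p by (intro iii[OF u]) (auto simp: lat_mem_U_iff)
      then show ?thesis
        using 2 by (intro through) (auto simp: algebra_simps)
    qed
  qed
qed

text \<open>Conditions (i), (iii) and (iv) come from the level differences 1, \<open>p\<close> and
  \<open>B\<close>: the first with zero displacement, the second by \<open>cone3_neg_p_iff\<close>,
  the third by \<open>cone3_of_cone2_gap\<close>. The converse is a case split on the level
  difference.\<close>

lemma down_iff:
  defines "B \<equiv> Max (proper_gaps p U i J)"
  shows "(\<forall>j<i. \<forall>u\<in>K. \<forall>w\<in>U. (w - u, real j - real i) \<in> \<Delta> p \<longrightarrow> w \<in> J j) \<longleftrightarrow>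
   (i \<ge> 1 \<longrightarrow> K \<subseteq> J (i - 1)) \<and>
   (i \<ge> p \<longrightarrow> (K + D p + {lat 1 0}) \<inter> U \<subseteq> J (i - p)) \<and>
   (proper_gaps p U i J \<noteq> {} \<longrightarrow>
     (K + D p + {lat 1 (- ((int p)^2) + int p * int B)}) \<inter> U \<subseteq> J (i - B))"
    (is "?down \<longleftrightarrow> ?i \<and> ?iii \<and> ?iv")
proof -
  have down: "?down \<longleftrightarrow> (\<forall>j<i. \<forall>a b c d. lat a b \<in> K \<longrightarrow> lat c d \<in> U \<longrightarrow>
      cone3 (int p) (c - a) (d - b) (int j - int i) \<longrightarrow> lat c d \<in> J j)"
    by (simp only: ball_Delta_iff[OF K_sub])
  have iii: "?iii \<longleftrightarrow> (i \<ge> p \<longrightarrow> (\<forall>a b c d. lat a b \<in> K \<longrightarrow> lat c d \<in> U \<longrightarrow>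
      cone2 (int p) (c - a - 1) (d - b) \<longrightarrow> lat c d \<in> J (i - p)))"
    by (simp add: translate_subset_iff[OF K_sub])
  have iv: "?iv \<longleftrightarrow> (proper_gaps p U i J \<noteq> {} \<longrightarrow>
      (\<forall>a b c d. lat a b \<in> K \<longrightarrow> lat c d \<in> U \<longrightarrow>
        cone2 (int p) (c - a - 1) (d - b - (- ((int p)^2) + int p * int B)) \<longrightarrow>
        lat c d \<in> J (i - B)))"
    by (simp only: translate_subset_iff[OF K_sub])
  show ?thesis
  proof (intro iffI conjI)
    assume down': ?down
    have D: "lat c d \<in> J (i - \<beta>)"
      if "1 \<le> \<beta>" "\<beta> \<le> i" "lat a b \<in> K" "lat c d \<in> U" "cone3 (int p) (c - a) (d - b) (- int \<beta>)"
      for \<beta> a b c d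
    proof -
      have "int (i - \<beta>) - int i = - int \<beta>" "i - \<beta> < i"
        using that by auto
      then show ?thesis
        using down' that unfolding down by metis
    qed
    show ?i
    proof (intro impI subsetI)
      fix u assume i: "1 \<le> i" and u: "u \<in> K"
      then obtain a b where ab: "u = lat a b"
        using K_sub U_cases by blast
      have "cone3 (int p) (a - a) (b - b) (- int 1)"
        using p by (subst cone3_nonpos_iff) auto
      then show "u \<in> J (i - 1)"
        using i u K_sub ab D[of 1 a b a b] by auto
    qed
    show ?iii
      unfolding iii using p D[of p] by (auto simp: cone3_neg_p_iff)
    show ?iv
      unfolding iv
    proof (intro impI allI)
      fix a b c d
      assume ne: "proper_gaps p U i J \<noteq> {}" and u: "lat a b \<in> K" and w: "lat c d \<in> U"
        and c: "cone2 (int p) (c - a - 1) (d - b - (- ((int p)^2) + int p * int B))"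
      have "B \<in> proper_gaps p U i J"
        unfolding B_def by (rule Max_in[OF finite_gaps ne])
      then have B: "B < p" "B \<le> i" "1 \<le> B"
        by (auto simp: proper_gaps_def)
      show "lat c d \<in> J (i - B)"
        using B p cone3_of_cone2_gap[OF _ _ _ c] by (intro D[OF _ _ u w]) auto
    qed
  next
    assume conds: "?i \<and> ?iii \<and> ?iv"
    show ?down
      unfolding down
    proof (intro allI impI)
      fix j a b c d
      assume j: "j < i" and u: "lat a b \<in> K" and w: "lat c d \<in> U"
        and c: "cone3 (int p) (c - a) (d - b) (int j - int i)"
      define \<beta> where "\<beta> = i - j"
      have \<beta>: "1 \<le> \<beta>" "\<beta> \<le> i" "j = i - \<beta>" and sub: "K \<subseteq> J (i - 1)"
        using j conds by (auto simp: \<beta>_def)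
      have c: "cone3 (int p) (c - a) (d - b) (- int \<beta>)"
        using c j by (simp add: \<beta>_def of_nat_diff)
      \<comment> \<open>A level with \<open>J j = U\<close> imposes nothing, so for
        \<open>\<beta> < p\<close> only the proper gaps remain.\<close>
      consider "\<beta> < p" "J j = U" | "\<beta> \<in> proper_gaps p U i J" | "\<beta> = p" | "p < \<beta>"
        using \<beta> by (force simp: proper_gaps_def)
      then show "lat c d \<in> J j"
      proof cases
        case 1
        then show ?thesis
          using w by simp
      next
        case 2
        then have "proper_gaps p U i J \<noteq> {}"
          by blast
        then have "\<And>a b c d. lat a b \<in> K \<Longrightarrow> lat c d \<in> U \<Longrightarrow>
            cone2 (int p) (c - a - 1) (d - b - (- ((int p)^2) + int p * int B)) \<Longrightarrow>
            lat c d \<in> J (i - B)"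
          using conds unfolding iv by blast
        from down_gap[OF sub 2 _ this u w c] show ?thesis
          by (simp add: B_def \<beta>)
      next
        case 3
        then show ?thesis
          using conds c u w \<beta> p unfolding iii by (auto simp: cone3_neg_p_iff)
      next
        case 4
        then have "\<And>a b c d. lat a b \<in> K \<Longrightarrow> lat c d \<in> U \<Longrightarrow>
            cone2 (int p) (c - a - 1) (d - b) \<Longrightarrow> lat c d \<in> J (i - p)"
          using conds \<beta> unfolding iii by auto
        from down_large[OF sub this 4 \<beta>(2) u w c] show ?thesis
          by (simp add: \<beta>)
      qed
    qed
  qed
qed

end

section \<open>Assembling the criterion\<close>

theorem theorem4p6:
  fixes p m n i :: nat
    and U :: "plane set"
    and J :: "nat \<Rightarrow> plane set"
    and Ji :: "plane set"
  assumes "prime p"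
    and "m > 0" and "3 dvd m"
    and "n = (m div 3) * (p - 1)"
    and "U = int_interval 0 (int n) \<times> int_interval 0 (int n)"
    and "i \<le> n"
    and "\<forall>j<i. is_ideal (D p) U (J j)"
    and "forward_consistent p U i J"
    and "is_ideal (D p) U Ji"
  shows "consistent p U i J Ji \<longleftrightarrow>
     (i \<ge> 1 \<longrightarrow> Ji \<subseteq> J (i - 1)) \<and>
     (i \<ge> 1 \<longrightarrow> (J (i - 1) + D p + {- (0, real p)}) \<inter> U \<subseteq> Ji) \<and>
     (i \<ge> p \<longrightarrow> (Ji + D p + {(1, 0)}) \<inter> U \<subseteq> J (i - p)) \<and>
     (proper_gaps p U i J \<noteq> {} \<longrightarrow>
        (let \<beta>\<^sub>i = Max (proper_gaps p U i J) in
          (Ji + D p + {(1, - ((real p)^2) + real p * real \<beta>\<^sub>i)}) \<inter> U \<subseteq> J (i - \<beta>\<^sub>i)))"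
proof -
  \<comment> \<open>A positive multiple of 3 is at least 3, which yields the bound
    \<open>n \<ge> p - 1\<close> of the locale.\<close>
  have "1 \<le> m div 3"
    using assms(2,3) by (auto elim!: dvdE)
  then have "1 * (p - 1) \<le> m div 3 * (p - 1)"
    by (rule mult_right_mono) simp
  then interpret grid p n i U J Ji
    using assms prime_ge_2_nat[of p] by unfold_locales auto
  let ?B = "Max (proper_gaps p U i J)"
  have pts: "lat 0 (- int p) = - (0, real p)" "lat 1 0 = (1, 0)"
    "lat 1 (- ((int p)^2) + int p * int ?B) = (1, - ((real p)^2) + real p * real ?B)"
    by (simp_all add: lat_def)
  show ?thesis
    unfolding consistent_iff[OF assms(7,8,9)] up_iff down_iff Let_def pts by blast
qed

end
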